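(* Assume the underlying statistical model described in the context, with true parameter $(\beta^{\ast},\beta_0^{\ast})\in\Theta$, noise variance $\gamma^2$ and $\Delta^2=(\beta^{\ast})^{\top}\Sigma\beta^{\ast}$. Let $$z^{\mathrm{asy}}=\inf_{y\ge0}\ \min_{(\beta,\beta_0)\in\Theta}\ \mathbb{E}_{X\sim\mathcal N,\,\epsilon\sim\mathcal D}\bigl[\psi_y(X^{\top}\beta+\beta_0,Y)\bigr],\qquad Y=\max\{0,X^{\top}\beta^{\ast}+\beta_0^{\ast}\}+\epsilon ,$$ where $$\psi_y(u,Y)=\begin{cases}\sigma(u,Y)&\text{if }0<Y\le y,\\ (u-Y)^2&\text{if }y<Y,\\ (\max\{0,u\}-Y)^2&\text{if }Y\le0.\end{cases}$$ Then $$\gamma^2\le z^{\mathrm{asy}}\le\frac{3\gamma^2}{2}+\frac{2+2\Delta^2}{\sqrt{2\pi}}\,\gamma .$$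
   Context: The function $\sigma$ is $\sigma(x,y)=(x-y)^2$ if $x>2y$ and $\sigma(x,y)=y^2$ if $x\le2y$. (For $y=0$ the first case in the definition of $\psi_y$ is empty and for $Y>0$ the second applies.) Underlying statistical model: $\Theta\subseteq\mathbb{R}^p\times\mathbb{R}$ is a convex compact set and $(\beta^{\ast},\beta_0^{\ast})\in\Theta$ is a fixed true parameter. Samples are $(X_i,Y_i)\in\mathbb{R}^p\times\mathbb{R}$ with $Y_i=\max\{0,X_i^{\top}\beta^{\ast}+\beta_0^{\ast}\}+\epsilon_i$, where the $X_i$ are i.i.d. from a distribution $\mathcal N$ on $\mathbb{R}^p$, the $\epsilon_i$ are i.i.d. from a distribution $\mathcal D$ on $\mathbb{R}$, and the $X$'s and $\epsilon$'s are independent. (In the expectation, $X\sim\mathcal N$ and $\epsilon\sim\mathcal D$ are independent.) The distributions satisfy: (1) $\mathbb{E}_{X\sim\mathcal N}[X]=0$ and $\mathrm{Var}_{X\sim\mathcal N}(X)=\Sigma$ is positive semidefinite (a finite covariance matrix); (2) (Unique Optimal Property) for any $(\beta,\beta_0)\in\Theta$ there exist $p+1$ vectors $v_1,\dots,v_{p+1}$ in the support of $\mathcal N$ with $v_i^{\top}\beta+\beta_0>0$ for all $i=1,\dots,p+1$ and with $(v_1,1),\dots,(v_{p+1},1)\in\mathbb{R}^{p+1}$ linearly independent; (3) $\mathcal D$ is the Gaussian distribution with mean $0$ and variance $\gamma^2$, $0<\gamma<\infty$. Consequently $\mathbb{E}[X^{\top}\beta^{\ast}+\beta_0^{\ast}]=\beta_0^{\ast}$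 and $\mathrm{Var}(X^{\top}\beta^{\ast}+\beta_0^{\ast})=(\beta^{\ast})^{\top}\Sigma\beta^{\ast}=:\Delta^2$. *)

theory Defs
  imports "HOL-Probability.Probability"
begin

definition sigma :: "real \<Rightarrow> real \<Rightarrow> real" where
  "sigma x y = (if x > 2 * y then (x - y)\<^sup>2 else y\<^sup>2)"

(* Only used for y \<ge> 0, where the three cases 0 < Y \<le> y, y < Y and Y \<le> 0 are
   mutually exclusive and exhaustive. *)
definition psi :: "real \<Rightarrow> real \<Rightarrow> real \<Rightarrow> real" where
  "psi y u Y =
     (if 0 < Y \<and> Y \<le> y then sigma u Y
      else if y < Y then (u - Y)\<^sup>2
      else (max 0 u - Y)\<^sup>2)"

definition measure_support :: "'a::topological_space measure \<Rightarrow> 'a set" where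
  "measure_support N = {x. \<forall>U. open U \<and> x \<in> U \<longrightarrow> emeasure N U > 0}"

definition covariance_matrix :: "(real ^ 'p) measure \<Rightarrow> real ^ 'p ^ 'p" where
  "covariance_matrix N =
     (\<chi> i j. \<integral>x. (x $ i - (\<integral>x'. x' $ i \<partial>N)) * (x $ j - (\<integral>x'. x' $ j \<partial>N)) \<partial>N)"

definition positive_semidefinite :: "real ^ 'p ^ 'p \<Rightarrow> bool" where
  "positive_semidefinite S \<longleftrightarrow> transpose S = S \<and> (\<forall>w. 0 \<le> w \<bullet> (S *v w))"

definition unique_optimal_property ::
  "(real ^ 'p) measure \<Rightarrow> ((real ^ 'p) \<times> real) set \<Rightarrow> bool" where
  "unique_optimal_property N \<Theta> \<longleftrightarrow>
     (\<forall>(\<beta>, \<beta>0) \<in> \<Theta>. \<exists>v :: nat \<Rightarrow> real ^ 'p.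
        (\<forall>i\<in>{1..CARD('p) + 1}. v i \<in> measure_support N \<and> v i \<bullet> \<beta> + \<beta>0 > 0) \<and>
        inj_on (\<lambda>i. (v i, 1 :: real)) {1..CARD('p) + 1} \<and>
        independent ((\<lambda>i. (v i, 1 :: real)) ` {1..CARD('p) + 1}))"

(* Independence of the covariate and the noise is expressed by the product law of
   (X, \<epsilon>); true_par is the parameter generating the response Y. *)
definition risk ::
  "(real ^ 'p) measure \<Rightarrow> real measure \<Rightarrow> (real ^ 'p) \<times> real \<Rightarrow> real \<Rightarrow> (real ^ 'p) \<times> real \<Rightarrow> real" where
  "risk N D true_par y par =
     (\<integral>(X, \<epsilon>). psi y (X \<bullet> fst par + snd par)
                   (max 0 (X \<bullet> fst true_par + snd true_par) + \<epsilon>) \<partial>(N \<Otimes>\<^sub>M D))"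

(* LEAST is the minimum of the set of risks; for compact \<Theta> and square-integrable N it is
   attained, because psi y u Y is continuous in u. *)
definition z_asy ::
  "(real ^ 'p) measure \<Rightarrow> real measure \<Rightarrow> ((real ^ 'p) \<times> real) set \<Rightarrow> (real ^ 'p) \<times> real \<Rightarrow> real" where
  "z_asy N D \<Theta> true_par = (INF y\<in>{0..}. LEAST r. r \<in> risk N D true_par y ` \<Theta>)"

end

theory Submission
  imports Defs
begin

text \<open>
  Lower bound: \<open>psi y u Y \<ge> (max 0 u - Y)\<^sup>2\<close> for every \<open>y \<ge> 0\<close>, and the noise is centred and independent
  of the covariate. The minimum over the compact parameter set exists by dominated convergence.

  Upper bound: evaluate the risk at the true parameter. With \<open>m\<close> the true linear predictor, the loss
  exceeds \<open>\<epsilon>\<^sup>2\<close> by at most \<open>y\<^sup>2\<close> if \<open>m \<ge> 0\<close>, and by \<open>m\<^sup>2 + 2 \<bar>m\<bar> \<epsilon>\<close> on the event \<open>\<epsilon> > y\<close> if \<open>m < 0\<close>.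
  Let \<open>d \<ge> \<bar>\<Delta>\<bar>\<close> be positive, let \<open>t\<close> be the negative part of the mean of \<open>m\<close> and \<open>S\<^sup>2 = d\<^sup>2 + t\<^sup>2\<close>. Cantelli's
  inequality bounds the first contribution by \<open>y\<^sup>2 d\<^sup>2 / S\<^sup>2\<close>, and the Gaussian tail bounds the second by a
  multiple of \<open>1 / y\<^sup>2\<close>; balancing the two in \<open>y\<close> gives \<open>3 \<gamma>\<^sup>2 / 2 + 4 d \<gamma> / sqrt (2 \<pi>)\<close>. The choice
  \<open>d = (1 + \<Delta>\<^sup>2) / 2\<close> turns this into the stated bound.
\<close>

section \<open>Pointwise bounds, continuity and measurability of the loss\<close>

text \<open>For Y > 0, clipping u at 0 moves it towards Y, and if also u \<le> 2 * Y, then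
  \<open>max 0 u\<close> lies in [0, 2 * Y], at distance at most Y from Y. For Y \<le> 0 there is
  equality.\<close>

lemma psi_ge: "(max 0 u - Y)\<^sup>2 \<le> psi y u Y" if "0 \<le> y"
proof -
  have "(max 0 u - Y)\<^sup>2 \<le> Y\<^sup>2" if "0 < Y" "u \<le> 2 * Y"
    using that by (intro abs_le_square_iff[THEN iffD1]) auto
  moreover have "(max 0 u - Y)\<^sup>2 \<le> (u - Y)\<^sup>2" if "0 < Y"
    using that by (intro abs_le_square_iff[THEN iffD1]) auto
  ultimately show ?thesis
    using that by (auto simp: psi_def sigma_def)
qed

lemma psi_nonneg: "0 \<le> psi y u Y"
  by (simp add: psi_def sigma_def)

text \<open>This quadratic majorant is independent of y; together with the second moments it
  supplies the dominating function in \<open>loss_le\<close>.\<close>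

lemma psi_le: "psi y u Y \<le> 2 * u\<^sup>2 + 2 * Y\<^sup>2"
proof -
  have *: "(v - Y)\<^sup>2 \<le> 2 * v\<^sup>2 + 2 * Y\<^sup>2" for v
    using zero_le_power2[of "v + Y"] unfolding power2_sum power2_diff by linarith
  have "(max 0 u)\<^sup>2 \<le> u\<^sup>2"
    by (auto simp: max_def)
  with *[of "max 0 u"] have "(max 0 u - Y)\<^sup>2 \<le> 2 * u\<^sup>2 + 2 * Y\<^sup>2"
    by linarith
  moreover have "Y\<^sup>2 \<le> 2 * u\<^sup>2 + 2 * Y\<^sup>2"
    by simp
  ultimately show ?thesis
    using *[of u] by (simp add: psi_def sigma_def)
qed

lemma continuous_sigma: "continuous_on UNIV (\<lambda>u. sigma u Y)"
proof -
  \<comment> \<open>The two branches agree at u = 2 * Y, so a single continuous expression covers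
    both.\<close>
  have "sigma u Y = (max u (2 * Y) - Y)\<^sup>2" for u
    by (auto simp: sigma_def max_def)
  then show ?thesis
    by (simp add: continuous_intros)
qed

lemma continuous_psi: "continuous_on UNIV (\<lambda>u. psi y u Y)"
  unfolding psi_def
  by (cases "0 < Y \<and> Y \<le> y"; cases "y < Y") (auto intro!: continuous_intros continuous_sigma)

lemma psi_measurable [measurable]:
  assumes [measurable]: "f \<in> borel_measurable M" "g \<in> borel_measurable M"
  shows "(\<lambda>x. psi y (f x) (g x)) \<in> borel_measurable M"
  unfolding psi_def sigma_def by measurable

section \<open>Product integrals and Gaussian estimates\<close>

lemma pair_integral_mult:
  fixes f :: "'a \<Rightarrow> real" and g :: "'b \<Rightarrow> real"
  assumes "prob_space M1" "prob_space M2" "integrable M1 f" "integrable M2 g"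
  shows "integrable (M1 \<Otimes>\<^sub>M M2) (\<lambda>z. f (fst z) * g (snd z))"
    and "(\<integral>z. f (fst z) * g (snd z) \<partial>(M1 \<Otimes>\<^sub>M M2)) = (\<integral>x. f x \<partial>M1) * (\<integral>y. g y \<partial>M2)"
proof -
  interpret M1: prob_space M1 by fact
  interpret M2: prob_space M2 by fact
  interpret pair_prob_space M1 M2 ..
  have [measurable]: "f \<in> borel_measurable M1" "g \<in> borel_measurable M2"
    using assms by auto
  show int: "integrable (M1 \<Otimes>\<^sub>M M2) (\<lambda>z. f (fst z) * g (snd z))"
    using assms by (intro Fubini_integrable) (auto simp: abs_mult)
  show "(\<integral>z. f (fst z) * g (snd z) \<partial>(M1 \<Otimes>\<^sub>M M2)) = (\<integral>x. f x \<partial>M1) * (\<integral>y. g y \<partial>M2)"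
    using integral_fst'[OF int] by simp
qed

text \<open>The maximum is 1 / e, at x = 1. The tangent bound exp (x - 1) \<ge> x and e \<ge> 1 + 1
  + 1 / 2 give the rational constant.\<close>

lemma exp_minus_mult_le: "x * exp (- x) \<le> 2 / 5" for x :: real
proof (cases "0 \<le> x")
  case True
  have "5 / 2 * x \<le> exp 1 * exp (x - 1)"
    using exp_lower_Taylor_quadratic[of 1] exp_ge_add_one_self[of "x - 1"] True
    by (intro mult_mono) auto
  also have "\<dots> = exp x" by (simp flip: exp_add)
  finally show ?thesis by (simp add: exp_minus field_simps)
next
  case False
  then have "x * exp (- x) \<le> 0" by (simp add: mult_nonpos_nonneg)
  then show ?thesis by linarith
qed

text \<open>The lower bound controls the normal density from above; the upper one, with reciprocal
  39 / 100, serves the final comparison of constants.\<close>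

lemma sqrt_2_pi_bounds: "5 / 2 \<le> sqrt (2 * pi)" "sqrt (2 * pi) \<le> 100 / 39"
proof -
  show "5 / 2 \<le> sqrt (2 * pi)"
    using pi_approx by (intro real_le_rsqrt) (simp add: power2_eq_square)
  show "sqrt (2 * pi) \<le> 100 / 39"
    using pi_approx by (intro real_le_lsqrt) (simp_all add: power2_eq_square)
qed

text \<open>With x = y^2 / (2 * \<gamma>^2), the square of the first quantity is 2 * x * exp (-2 *
  x) / (2 * pi), and the second is 2 * \<gamma> * x * exp (-x) / sqrt (2 * pi);
  \<open>exp_minus_mult_le\<close> bounds both.\<close>

lemma normal_density_mult_le: "y * normal_density 0 \<gamma> y \<le> 13 / 50"
  and normal_density_mult_power2_le: "y\<^sup>2 * normal_density 0 \<gamma> y \<le> 8 / 25 * \<gamma>"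
  if "0 < y" "0 < \<gamma>"
proof -
  let ?x = "y\<^sup>2 / (2 * \<gamma>\<^sup>2)" and ?r = "sqrt (2 * pi)"
  have nd: "normal_density 0 \<gamma> y = exp (- ?x) / (?r * \<gamma>)"
    using that by (simp add: normal_density_def real_sqrt_mult)
  have r: "5 / 2 \<le> ?r" by (fact sqrt_2_pi_bounds)
  then have r2: "(5 / 2)\<^sup>2 \<le> ?r\<^sup>2" by (intro power_mono) auto
  have "(y * normal_density 0 \<gamma> y)\<^sup>2 = 2 * (?x * exp (- ?x) * exp (- ?x)) / ?r\<^sup>2"
    using that unfolding nd by (simp add: field_simps power2_eq_square)
  also have "?x * exp (- ?x) * exp (- ?x) = (2 * ?x) * exp (- (2 * ?x)) / 2"
    by (simp add: mult.assoc mult_exp_exp)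
  also have "2 * ((2 * ?x) * exp (- (2 * ?x)) / 2) / ?r\<^sup>2 \<le> (2 / 5) / (5 / 2)\<^sup>2"
    using exp_minus_mult_le[of "2 * ?x"] r2 by (intro frac_le) auto
  also have "\<dots> \<le> (13 / 50)\<^sup>2" by (simp add: power2_eq_square)
  finally show "y * normal_density 0 \<gamma> y \<le> 13 / 50"
    by (rule power2_le_imp_le) simp
  have "y\<^sup>2 * normal_density 0 \<gamma> y = 2 * (?x * exp (- ?x)) / ?r * \<gamma>"
    using that unfolding nd by (simp add: field_simps power2_eq_square)
  also have "\<dots> \<le> 2 * (2 / 5) / (5 / 2) * \<gamma>"
    using exp_minus_mult_le[of ?x] r that by (intro mult_right_mono frac_le mult_left_mono) auto
  finally show "y\<^sup>2 * normal_density 0 \<gamma> y \<le> 8 / 25 * \<gamma>" by simp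
qed

lemma normal_moments:
  assumes "0 < \<gamma>" and D: "D = density lborel (normal_density 0 \<gamma>)"
  shows "integrable D (\<lambda>e. e)" "(\<integral>e. e \<partial>D) = 0"
    and "integrable D (\<lambda>e. e\<^sup>2)" "(\<integral>e. e\<^sup>2 \<partial>D) = \<gamma>\<^sup>2"
proof -
  show "integrable D (\<lambda>e. e)" "(\<integral>e. e \<partial>D) = 0"
    using integrable_normal_moment_nz_1[OF assms(1), of 0] integral_normal_moment_nz_1[OF assms(1), of 0]
    by (simp_all add: D integrable_density integral_density)
  show "integrable D (\<lambda>e. e\<^sup>2)" "(\<integral>e. e\<^sup>2 \<partial>D) = \<gamma>\<^sup>2"
    using integrable_normal_moment[OF assms(1), of 0 2] integral_normal_moment_even[OF assms(1), of 0 1]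
    by (simp_all add: D integrable_density integral_density)
qed

lemma normal_density_antideriv:
  assumes "0 < \<gamma>"
  shows "((\<lambda>x. - (\<gamma>\<^sup>2 * normal_density 0 \<gamma> x)) has_real_derivative normal_density 0 \<gamma> x * x) (at x)"
proof -
  let ?c = "1 / sqrt (2 * pi * \<gamma>\<^sup>2)"
  have "((\<lambda>x. - x\<^sup>2 / (2 * \<gamma>\<^sup>2)) has_real_derivative - x / \<gamma>\<^sup>2) (at x)"
    using DERIV_cdivide[OF DERIV_minus[OF DERIV_pow[of 2 x]], of "2 * \<gamma>\<^sup>2"]
    by (simp add: field_simps)
  note exp = DERIV_chain2[OF DERIV_exp this]
  have nd: "normal_density 0 \<gamma> = (\<lambda>x. ?c * exp (- x\<^sup>2 / (2 * \<gamma>\<^sup>2)))"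
    by (simp add: normal_density_def fun_eq_iff)
  show ?thesis
    unfolding nd using assms
    by (intro DERIV_cong[OF DERIV_minus[OF DERIV_cmult[OF DERIV_cmult[OF exp]]]])
      (simp add: power2_eq_square)
qed

text \<open>By \<open>normal_density_antideriv\<close> the integrand has an explicit antiderivative
  that vanishes at infinity, so only the boundary term at y remains.\<close>

lemma normal_tail_moment:
  assumes "0 < \<gamma>" "0 \<le> y" and D: "D = density lborel (normal_density 0 \<gamma>)"
  shows "integrable D (\<lambda>e. e * indicator {y..} e)"
    and "(\<integral>e. e * indicator {y..} e \<partial>D) = \<gamma>\<^sup>2 * normal_density 0 \<gamma> y"
proof -
  let ?n = "normal_density 0 \<gamma>"
  have "\<forall>\<^sub>F x in at_top. ?n x \<le> 13 / 50 / x"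
    using eventually_gt_at_top[of 0]
  proof eventually_elim
    case (elim x)
    then show ?case
      using normal_density_mult_le[OF elim assms(1)] by (simp add: field_simps)
  qed
  moreover have "((\<lambda>x::real. 13 / 50 / x) \<longlongrightarrow> 0) at_top"
    by (intro tendsto_divide_0[OF tendsto_const] filterlim_at_top_imp_at_infinity filterlim_ident)
  ultimately have "(?n \<longlongrightarrow> 0) at_top"
    using tendsto_sandwich[of "\<lambda>_. 0" ?n at_top "\<lambda>x. 13 / 50 / x" 0] by simp
  then have "((\<lambda>x. - (\<gamma>\<^sup>2 * ?n x)) \<longlongrightarrow> - (\<gamma>\<^sup>2 * 0)) at_top"
    by (intro tendsto_intros)
  then have lim: "((\<lambda>x. - (\<gamma>\<^sup>2 * ?n x)) \<longlongrightarrow> 0) at_top" by simp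
  have "(\<integral>\<^sup>+x. ennreal (?n x * x) * indicator {y..} x \<partial>lborel) = 0 - (- (\<gamma>\<^sup>2 * ?n y))"
    using assms(2) by (intro nn_integral_FTC_atLeast normal_density_antideriv assms(1) lim) auto
  moreover have "(\<integral>\<^sup>+x. ennreal (?n x * x) * indicator {y..} x \<partial>lborel) =
      (\<integral>\<^sup>+x. ennreal (?n x * (x * indicator {y..} x)) \<partial>lborel)"
    by (intro nn_integral_cong) (auto split: split_indicator)
  ultimately have nn: "(\<integral>\<^sup>+x. ennreal (?n x * (x * indicator {y..} x)) \<partial>lborel) = ennreal (\<gamma>\<^sup>2 * ?n y)"
    by simp
  have "has_bochner_integral lborel (\<lambda>x. ?n x * (x * indicator {y..} x)) (\<gamma>\<^sup>2 * ?n y)"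
    using assms(2) nn by (intro has_bochner_integral_nn_integral) (auto split: split_indicator)
  then show "integrable D (\<lambda>e. e * indicator {y..} e)"
    and "(\<integral>e. e * indicator {y..} e \<partial>D) = \<gamma>\<^sup>2 * ?n y"
    by (simp_all add: D integrable_density integral_density has_bochner_integral_iff)
qed


section \<open>Excess of the loss at the true parameter over the squared noise\<close>

text \<open>
  \<open>(t * \<xi> + d\<^sup>2)\<^sup>2 / S ^ 4\<close> is the quadratic majorant of the indicator of \<open>\<xi> + b \<ge> 0\<close> from the proof of
  Cantelli's inequality; for \<open>b \<ge> 0\<close> it is the constant 1.
\<close>
lemma psi_excess_le:
  assumes "0 < y" "0 < d" "0 < S" "S\<^sup>2 = d\<^sup>2 + t\<^sup>2" and t: "t = max 0 (- b)"
  shows "psi y (\<xi> + b) (max 0 (\<xi> + b) + e) \<le>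
    e\<^sup>2 + y\<^sup>2 * ((t * \<xi> + d\<^sup>2)\<^sup>2 / S ^ 4) +
    ((1 / y + 1 / S) * (\<xi> - t)\<^sup>2 + S) * (e * indicator {y..} e)"
proof -
  have ind: "0 \<le> e * indicator {y..} e"
    using assms(1) by (auto split: split_indicator)
  show ?thesis
  proof (cases "0 \<le> \<xi> + b")
    case True
    have S4: "S ^ 4 = (d\<^sup>2 + t\<^sup>2)\<^sup>2"
      unfolding assms(4)[symmetric] by (simp flip: power_mult)
    \<comment> \<open>If b < 0, then t = -b \<le> \<xi>; either way t * \<xi> \<ge> t^2, so the
      majorant is at least 1 on this event.\<close>
    have "t = 0 \<or> t \<le> \<xi>" "0 \<le> t"
      using True t by auto
    then have "t * t \<le> t * \<xi>"
      by (auto intro: mult_left_mono)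
    then have "(d\<^sup>2 + t\<^sup>2)\<^sup>2 \<le> (t * \<xi> + d\<^sup>2)\<^sup>2"
      by (intro power_mono) (auto simp: power2_eq_square)
    then have "1 \<le> (t * \<xi> + d\<^sup>2)\<^sup>2 / S ^ 4"
      using assms(2) S4 by (simp add: le_divide_eq_1 sum_power2_gt_zero_iff)
    from mult_left_mono[OF this, of "y\<^sup>2"]
    have 1: "y\<^sup>2 \<le> y\<^sup>2 * ((t * \<xi> + d\<^sup>2)\<^sup>2 / S ^ 4)" by simp
    have 2: "0 \<le> ((1 / y + 1 / S) * (\<xi> - t)\<^sup>2 + S) * (e * indicator {y..} e)"
      using assms(1,3) by (intro mult_nonneg_nonneg[OF _ ind]) simp
    \<comment> \<open>The loss is e^2 here unless \<open>sigma\<close> takes its branch Y^2, which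
      occurs only for Y \<le> y.\<close>
    have "Y\<^sup>2 \<le> y\<^sup>2" if "0 < Y" "Y \<le> y" for Y
      using that by (intro power_mono) auto
    then have "psi y (\<xi> + b) (max 0 (\<xi> + b) + e) \<le> e\<^sup>2 + y\<^sup>2"
      using True by (simp add: psi_def sigma_def add_increasing)
    with 1 2 show ?thesis by linarith
  next
    case False
    define m where "m = - (\<xi> + b)"
    have m: "0 < m" using False by (simp add: m_def)
    have "m\<^sup>2 \<le> (\<xi> - t)\<^sup>2"
      using False t unfolding m_def by (intro abs_le_square_iff[THEN iffD1]) (auto simp: max_def)
    \<comment> \<open>The linear term is traded for a quadratic one, so that only the second moment
      of \<xi> enters after integration.\<close>
    moreover have "2 * m \<le> m\<^sup>2 / S + S"
      using zero_le_power2[of "m - S"] assms(3) by (simp add: power2_diff field_simps power2_eq_square)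
    ultimately have "m\<^sup>2 / y + 2 * m \<le> (\<xi> - t)\<^sup>2 / y + ((\<xi> - t)\<^sup>2 / S + S)"
      using assms(1,3) by (smt (verit) divide_right_mono)
    also have "\<dots> = (1 / y + 1 / S) * (\<xi> - t)\<^sup>2 + S"
      by (simp add: field_simps)
    finally have *: "m\<^sup>2 / y + 2 * m \<le> (1 / y + 1 / S) * (\<xi> - t)\<^sup>2 + S" .
    have "psi y (- m) e \<le> e\<^sup>2 + (m\<^sup>2 / y + 2 * m) * (e * indicator {y..} e)"
    proof (cases "y < e")
      case True
      \<comment> \<open>Here the loss is (m + e)^2. The factor e / y > 1 makes the excess m^2 + 2 *
        m * e proportional to e, so that a single tail moment suffices.\<close>
      then have "m\<^sup>2 * 1 \<le> m\<^sup>2 * (e / y)"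
        using assms(1) by (intro mult_left_mono) auto
      with True assms(1) show ?thesis
        by (simp add: psi_def power2_eq_square algebra_simps)
    next
      case False
      then have "psi y (- m) e = e\<^sup>2"
        using m assms(1) by (auto simp: psi_def sigma_def)
      moreover have "0 \<le> (m\<^sup>2 / y + 2 * m) * (e * indicator {y..} e)"
        using m assms(1) by (intro mult_nonneg_nonneg[OF _ ind]) simp
      ultimately show ?thesis by linarith
    qed
    also have "(m\<^sup>2 / y + 2 * m) * (e * indicator {y..} e) \<le>
        ((1 / y + 1 / S) * (\<xi> - t)\<^sup>2 + S) * (e * indicator {y..} e)"
      by (intro mult_right_mono * ind)
    moreover have "0 \<le> y\<^sup>2 * ((t * \<xi> + d\<^sup>2)\<^sup>2 / S ^ 4)" by simp
    ultimately have "psi y (- m) e \<le> e\<^sup>2 + y\<^sup>2 * ((t * \<xi> + d\<^sup>2)\<^sup>2 / S ^ 4) +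
      ((1 / y + 1 / S) * (\<xi> - t)\<^sup>2 + S) * (e * indicator {y..} e)"
      by linarith
    moreover have "\<xi> + b = - m" "max 0 (\<xi> + b) = 0" using False by (auto simp: m_def)
    ultimately show ?thesis by simp
  qed
qed

section \<open>Integrability and continuity of the risk; existence of its minimum\<close>

locale gaussian_regression = prob_space N
  for N :: "(real ^ 'p) measure" +
  fixes D :: "real measure" and \<gamma> :: real
  assumes sets_N [measurable_cong]: "sets N = sets borel"
    and integrable_norm2: "integrable N (\<lambda>x. (norm x)\<^sup>2)"
    and gamma_pos: "0 < \<gamma>"
    and D_normal: "D = density lborel (normal_density 0 \<gamma>)"
begin

sublocale D: prob_space D
  unfolding D_normal using gamma_pos by (rule prob_space_normal_density)

lemma sets_D [measurable_cong]: "sets D = sets borel"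
  by (simp add: D_normal)

lemma integrable_inner2: "integrable N (\<lambda>x. (x \<bullet> b)\<^sup>2)"
proof (rule Bochner_Integration.integrable_bound)
  show "integrable N (\<lambda>x. (norm b)\<^sup>2 * (norm x)\<^sup>2)"
    using integrable_norm2 by simp
  have "(x \<bullet> b)\<^sup>2 \<le> (norm b)\<^sup>2 * (norm x)\<^sup>2" for x
    using Cauchy_Schwarz_ineq[of x b] by (simp add: power2_norm_eq_inner mult.commute)
  then show "AE x in N. norm ((x \<bullet> b)\<^sup>2) \<le> norm ((norm b)\<^sup>2 * (norm x)\<^sup>2)"
    by simp
qed measurable

lemma integrable_inner: "integrable N (\<lambda>x. x \<bullet> b)"
  using integrable_inner2[of b] by (rule square_integrable_imp_integrable[rotated]) measurable

text \<open>The integrand of \<open>risk\<close>, written with projections to match the product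
  integrals.\<close>

definition loss :: "(real ^ 'p) \<times> real \<Rightarrow> real \<Rightarrow> (real ^ 'p) \<times> real \<Rightarrow> (real ^ 'p) \<times> real \<Rightarrow> real" where
  "loss tp y par z =
     psi y (fst z \<bullet> fst par + snd par) (max 0 (fst z \<bullet> fst tp + snd tp) + snd z)"

lemma risk_eq: "risk N D tp y par = (\<integral>z. loss tp y par z \<partial>(N \<Otimes>\<^sub>M D))"
  by (simp add: risk_def loss_def case_prod_unfold)

lemma measurable_loss [measurable]: "loss tp y par \<in> borel_measurable (N \<Otimes>\<^sub>M D)"
  unfolding loss_def[abs_def] by measurable

lemma affine_square_le:
  fixes x :: "real ^ 'p" and par :: "(real ^ 'p) \<times> real"
  assumes "norm par \<le> B"
  shows "(x \<bullet> fst par + snd par)\<^sup>2 \<le> 2 * B\<^sup>2 * ((norm x)\<^sup>2 + 1)"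
proof -
  have B: "norm (fst par) \<le> B" "\<bar>snd par\<bar> \<le> B"
    using norm_fst_le[of "fst par" "snd par"] norm_snd_le[of "snd par" "fst par"] assms by auto
  have "\<bar>x \<bullet> fst par\<bar> \<le> norm x * B"
    using Cauchy_Schwarz_ineq2[of x "fst par"] mult_left_mono[OF B(1), of "norm x"] by simp
  then have "\<bar>x \<bullet> fst par + snd par\<bar> \<le> \<bar>B * (norm x + 1)\<bar>"
    using B by (simp add: algebra_simps)
  then have "(x \<bullet> fst par + snd par)\<^sup>2 \<le> (B * (norm x + 1))\<^sup>2"
    by (simp only: abs_le_square_iff)
  also have "\<dots> = B\<^sup>2 * (norm x + 1)\<^sup>2" by (simp add: power_mult_distrib)
  also have "\<dots> \<le> B\<^sup>2 * (2 * ((norm x)\<^sup>2 + 1))"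
    using zero_le_power2[of "norm x - 1"]
    by (intro mult_left_mono) (simp_all add: power2_sum power2_diff)
  finally show ?thesis by (simp add: algebra_simps)
qed

text \<open>The majorant is uniform in y and over the ball of radius B. Its coefficients come from
  \<open>psi_le\<close> and Y^2 \<le> 2 * m^2 + 2 * e^2: 12 = 2 * 2 + 4 * 2, where each affine
  square contributes a factor 2, and 4 = 2 * 2.\<close>

lemma loss_le:
  assumes "norm par \<le> B" "norm tp \<le> B"
  shows "loss tp y par z \<le> 12 * B\<^sup>2 * ((norm (fst z))\<^sup>2 + 1) + 4 * (snd z)\<^sup>2"
proof -
  let ?m = "fst z \<bullet> fst tp + snd tp"
  have "(max 0 ?m + snd z)\<^sup>2 \<le> 2 * (max 0 ?m)\<^sup>2 + 2 * (snd z)\<^sup>2"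
    using zero_le_power2[of "max 0 ?m - snd z"] unfolding power2_sum power2_diff by linarith
  moreover have "(max 0 ?m)\<^sup>2 \<le> ?m\<^sup>2"
    by (auto simp: max_def)
  ultimately show ?thesis
    using psi_le[of y "fst z \<bullet> fst par + snd par" "max 0 ?m + snd z"]
      affine_square_le[OF assms(1), of "fst z"] affine_square_le[OF assms(2), of "fst z"]
    unfolding loss_def by argo
qed

lemmas noise_moments = normal_moments[OF gamma_pos D_normal]

lemma product_integral:
  fixes f :: "real ^ 'p \<Rightarrow> real" and g :: "real \<Rightarrow> real"
  assumes "integrable N f" "integrable D g"
  shows "integrable (N \<Otimes>\<^sub>M D) (\<lambda>z. f (fst z) * g (snd z))"
    and "(\<integral>z. f (fst z) * g (snd z) \<partial>(N \<Otimes>\<^sub>M D)) = (\<integral>x. f x \<partial>N) * (\<integral>e. g e \<partial>D)"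
  by (rule pair_integral_mult[OF prob_space_axioms D.prob_space_axioms assms])+

lemma product_integral_fst:
  fixes f :: "real ^ 'p \<Rightarrow> real"
  assumes "integrable N f"
  shows "integrable (N \<Otimes>\<^sub>M D) (\<lambda>z. f (fst z))"
    and "(\<integral>z. f (fst z) \<partial>(N \<Otimes>\<^sub>M D)) = (\<integral>x. f x \<partial>N)"
  using product_integral[OF assms, of "\<lambda>_. 1"] by (simp_all add: D.prob_space)

lemma product_integral_snd:
  fixes g :: "real \<Rightarrow> real"
  assumes "integrable D g"
  shows "integrable (N \<Otimes>\<^sub>M D) (\<lambda>z. g (snd z))"
    and "(\<integral>z. g (snd z) \<partial>(N \<Otimes>\<^sub>M D)) = (\<integral>e. g e \<partial>D)"
  using product_integral[OF _ assms, of "\<lambda>_. 1"] by (simp_all add: prob_space)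

lemma integrable_majorant:
  "integrable (N \<Otimes>\<^sub>M D) (\<lambda>z. 12 * B\<^sup>2 * ((norm (fst z))\<^sup>2 + 1) + 4 * (snd z)\<^sup>2)"
proof -
  have 1: "integrable N (\<lambda>x. 12 * B\<^sup>2 * ((norm x)\<^sup>2 + 1))"
    using integrable_norm2 by simp
  have 2: "integrable D (\<lambda>e. 4 * e\<^sup>2)"
    using noise_moments(3) by simp
  from Bochner_Integration.integrable_add[OF product_integral_fst(1)[OF 1] product_integral_snd(1)[OF 2]]
  show ?thesis .
qed

lemma integrable_loss: "integrable (N \<Otimes>\<^sub>M D) (loss tp y par)"
proof (rule Bochner_Integration.integrable_bound[OF integrable_majorant])
  let ?B = "max (norm tp) (norm par)"
  have "norm (loss tp y par z) \<le>
      norm (12 * ?B\<^sup>2 * ((norm (fst z))\<^sup>2 + 1) + 4 * (snd z)\<^sup>2)" for z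
    using loss_le[of par ?B tp y z] psi_nonneg by (simp add: loss_def)
  then show "AE z in N \<Otimes>\<^sub>M D. norm (loss tp y par z) \<le>
      norm (12 * ?B\<^sup>2 * ((norm (fst z))\<^sup>2 + 1) + 4 * (snd z)\<^sup>2)"
    by simp
qed measurable

lemma continuous_risk:
  assumes "bounded S"
  shows "continuous_on S (risk N D tp y)"
  unfolding continuous_on_sequentially
proof safe
  fix x a assume x: "\<forall>n. x n \<in> S" "x \<longlonglongrightarrow> a" and a: "a \<in> S"
  obtain B0 where B0: "\<And>p. p \<in> S \<Longrightarrow> norm p \<le> B0"
    using assms by (auto simp: bounded_iff)
  define B where "B = max B0 (norm tp)"
  have B: "norm p \<le> B" if "p \<in> S" for p
    using B0[OF that] by (simp add: B_def)
  show "(risk N D tp y \<circ> x) \<longlonglongrightarrow> risk N D tp y a"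
    unfolding comp_def risk_eq
  proof (rule integral_dominated_convergence[OF _ _ integrable_majorant[of B]])
    show "AE z in N \<Otimes>\<^sub>M D. (\<lambda>n. loss tp y (x n) z) \<longlonglongrightarrow> loss tp y a z"
      unfolding loss_def
      by (intro AE_I2 continuous_on_tendsto_compose[OF continuous_psi] tendsto_intros x) auto
    show "AE z in N \<Otimes>\<^sub>M D. norm (loss tp y (x n) z) \<le>
        12 * B\<^sup>2 * ((norm (fst z))\<^sup>2 + 1) + 4 * (snd z)\<^sup>2" for n
    proof (rule AE_I2)
      fix z
      have "norm (loss tp y (x n) z) = loss tp y (x n) z"
        by (simp add: loss_def psi_nonneg)
      also have "\<dots> \<le> 12 * B\<^sup>2 * ((norm (fst z))\<^sup>2 + 1) + 4 * (snd z)\<^sup>2"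
        by (rule loss_le) (use B x(1) in \<open>auto simp: B_def\<close>)
      finally show "norm (loss tp y (x n) z) \<le> \<dots>" .
    qed
  qed measurable
qed

text \<open>\<open>LEAST\<close> on the reals is meaningful only when a minimum is attained;
  compactness and \<open>continuous_risk\<close> provide one.\<close>

lemma Least_risk:
  assumes "compact \<Theta>" "tp \<in> \<Theta>"
  shows "(LEAST r. r \<in> risk N D tp y ` \<Theta>) \<in> risk N D tp y ` \<Theta>"
    and "(LEAST r. r \<in> risk N D tp y ` \<Theta>) \<le> risk N D tp y tp"
proof -
  obtain p where p: "p \<in> \<Theta>" "\<And>q. q \<in> \<Theta> \<Longrightarrow> risk N D tp y p \<le> risk N D tp y q"
    using continuous_attains_inf[OF assms(1) _ continuous_risk] assms
    by (metis compact_imp_bounded empty_iff)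
  then have "(LEAST r. r \<in> risk N D tp y ` \<Theta>) = risk N D tp y p"
    by (intro Least_equality) auto
  with p assms(2) show "(LEAST r. r \<in> risk N D tp y ` \<Theta>) \<in> risk N D tp y ` \<Theta>"
    and "(LEAST r. r \<in> risk N D tp y ` \<Theta>) \<le> risk N D tp y tp"
    by auto
qed

section \<open>Lower bound for the risk, and upper bound at the true parameter\<close>

text \<open>By \<open>psi_ge\<close> the loss is at least (h - e)^2 \<ge> e^2 - 2 * h * e, with h
  the difference of the two clipped predictors. Independence and centred noise kill the cross
  term.\<close>

lemma risk_ge:
  assumes "0 \<le> y"
  shows "\<gamma>\<^sup>2 \<le> risk N D tp y par"
proof -
  define h where "h x = max 0 (x \<bullet> fst par + snd par) - max 0 (x \<bullet> fst tp + snd tp)" for x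
  have h: "integrable N h"
    unfolding h_def by (intro Bochner_Integration.integrable_diff integrable_max
        Bochner_Integration.integrable_add integrable_inner) auto
  note hI = product_integral[OF h noise_moments(1)]
  note eI = product_integral_snd[OF noise_moments(3)]
  have "\<gamma>\<^sup>2 = (\<integral>z. (snd z)\<^sup>2 - 2 * (h (fst z) * snd z) \<partial>(N \<Otimes>\<^sub>M D))"
    using hI eI by (simp add: noise_moments)
  also have "\<dots> \<le> (\<integral>z. loss tp y par z \<partial>(N \<Otimes>\<^sub>M D))"
  proof (rule integral_mono)
    show "integrable (N \<Otimes>\<^sub>M D) (\<lambda>z. (snd z)\<^sup>2 - 2 * (h (fst z) * snd z))"
      using hI eI by simp
    fix z :: "(real ^ 'p) \<times> real"
    have "(snd z)\<^sup>2 - 2 * (h (fst z) * snd z) \<le> (h (fst z) - snd z)\<^sup>2"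
      by (simp add: power2_diff)
    also have "\<dots> \<le> loss tp y par z"
      using psi_ge[OF assms, of "fst z \<bullet> fst par + snd par" "max 0 (fst z \<bullet> fst tp + snd tp) + snd z"]
      by (simp add: loss_def h_def diff_diff_eq)
    finally show "(snd z)\<^sup>2 - 2 * (h (fst z) * snd z) \<le> loss tp y par z" .
  qed (rule integrable_loss)
  finally show ?thesis by (simp add: risk_eq)
qed

text \<open>Integrating \<open>psi_excess_le\<close>: \<open>f\<close> depends on the covariate
  alone, and independence splits the mean of \<open>g\<close> from the Gaussian tail moment.\<close>

lemma risk_true_le:
  assumes mean: "(\<integral>x. x \<bullet> fst tp \<partial>N) = 0" and var: "(\<integral>x. (x \<bullet> fst tp)\<^sup>2 \<partial>N) \<le> d\<^sup>2"
    and "0 < y" "0 < d" "0 < S" and S: "S\<^sup>2 = d\<^sup>2 + t\<^sup>2" and t: "t = max 0 (- snd tp)"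
  shows "risk N D tp y tp \<le> \<gamma>\<^sup>2 + y\<^sup>2 * (d\<^sup>2 / S\<^sup>2) +
    (S\<^sup>2 / y + 2 * S) * (\<gamma>\<^sup>2 * normal_density 0 \<gamma> y)"
proof -
  let ?b = "fst tp"
  let ?V = "\<integral>x. (x \<bullet> ?b)\<^sup>2 \<partial>N"
  note [simp] = integrable_inner integrable_inner2
  define f where "f x = y\<^sup>2 * ((t * (x \<bullet> ?b) + d\<^sup>2)\<^sup>2 / S ^ 4)" for x
  define g where "g x = (1 / y + 1 / S) * (x \<bullet> ?b - t)\<^sup>2 + S" for x
  \<comment> \<open>The cross term vanishes because the linear form is centred.\<close>
  have quad: "integrable N (\<lambda>x. (p * (x \<bullet> ?b) + q)\<^sup>2)"
    "(\<integral>x. (p * (x \<bullet> ?b) + q)\<^sup>2 \<partial>N) = p\<^sup>2 * ?V + q\<^sup>2" for p q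
    using mean by (simp_all add: power2_sum power_mult_distrib prob_space)
  have f: "integrable N f" "(\<integral>x. f x \<partial>N) = y\<^sup>2 * ((t\<^sup>2 * ?V + (d\<^sup>2)\<^sup>2) / S ^ 4)"
    unfolding f_def by (simp_all add: quad)
  have g: "integrable N g" "(\<integral>x. g x \<partial>N) = (1 / y + 1 / S) * (?V + t\<^sup>2) + S"
    using quad[of 1 "- t"] unfolding g_def by (simp_all add: prob_space)
  note tail = normal_tail_moment[OF gamma_pos less_imp_le[OF assms(3)] D_normal]
  note I = product_integral_snd[OF noise_moments(3)] product_integral_fst[OF f(1)]
    product_integral[OF g(1) tail(1)]
  have "risk N D tp y tp \<le>
      (\<integral>z. (snd z)\<^sup>2 + f (fst z) + g (fst z) * (snd z * indicator {y..} (snd z)) \<partial>(N \<Otimes>\<^sub>M D))"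
    unfolding risk_eq
    using psi_excess_le[OF assms(3-5) S t] I
    by (intro integral_mono integrable_loss) (auto simp: loss_def f_def g_def)
  also have "\<dots> = \<gamma>\<^sup>2 + (\<integral>x. f x \<partial>N) + (\<integral>x. g x \<partial>N) * (\<gamma>\<^sup>2 * normal_density 0 \<gamma> y)"
    using I by (simp add: noise_moments tail)
  also have "\<dots> \<le> \<gamma>\<^sup>2 + y\<^sup>2 * (d\<^sup>2 / S\<^sup>2) + (S\<^sup>2 / y + 2 * S) * (\<gamma>\<^sup>2 * normal_density 0 \<gamma> y)"
  proof (intro add_mono mult_right_mono order_refl)
    \<comment> \<open>This is Cantelli's bound: the mean of the majorant is at most d^2 * (t^2 +
      d^2) / S^4 = d^2 / S^2.\<close>
    have "t\<^sup>2 * ?V + (d\<^sup>2)\<^sup>2 \<le> t\<^sup>2 * d\<^sup>2 + (d\<^sup>2)\<^sup>2"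
      using var by (intro add_mono mult_left_mono) auto
    also have "\<dots> = d\<^sup>2 * S\<^sup>2"
      unfolding S by (simp add: algebra_simps power2_eq_square)
    finally have "(t\<^sup>2 * ?V + (d\<^sup>2)\<^sup>2) / S ^ 4 \<le> d\<^sup>2 * S\<^sup>2 / S ^ 4"
      by (intro divide_right_mono) auto
    also have "\<dots> = d\<^sup>2 / S\<^sup>2"
      using assms(5) by (simp add: field_simps power2_eq_square power4_eq_xxxx)
    finally show "(\<integral>x. f x \<partial>N) \<le> y\<^sup>2 * (d\<^sup>2 / S\<^sup>2)"
      unfolding f(2) by (intro mult_left_mono) auto
    have "(1 / y + 1 / S) * (?V + t\<^sup>2) \<le> (1 / y + 1 / S) * S\<^sup>2"
      using var S assms(3,5) by (intro mult_left_mono) auto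
    also have "\<dots> = S\<^sup>2 / y + S"
      using assms(3,5) by (simp add: field_simps power2_eq_square)
    finally show "(\<integral>x. g x \<partial>N) \<le> S\<^sup>2 / y + 2 * S"
      unfolding g(2) by simp
  qed auto
  finally show ?thesis .
qed

lemma exists_risk_true_le:
  assumes mean: "(\<integral>x. x \<bullet> fst tp \<partial>N) = 0" and var: "(\<integral>x. (x \<bullet> fst tp)\<^sup>2 \<partial>N) \<le> d\<^sup>2"
    and d: "0 < d"
  shows "\<exists>y\<ge>0. risk N D tp y tp \<le> 3 / 2 * \<gamma>\<^sup>2 + 39 / 25 * d * \<gamma>"
proof -
  define t where "t = max 0 (- snd tp)"
  define S where "S = sqrt (d\<^sup>2 + t\<^sup>2)"
  define G where "G = \<gamma> * (\<gamma> / 4 + 39 / 50 * S)"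
  define y where "y = sqrt (G * S / d)"
  \<comment> \<open>\<open>G\<close> is a linear upper bound for the square root of \<open>C\<close>, so this \<open>y\<close> nearly minimises \<open>y\<^sup>2 d\<^sup>2 / S\<^sup>2 + C / y\<^sup>2\<close>.\<close>
  define C where "C = \<gamma>\<^sup>2 * (13 / 50 * S\<^sup>2 + 16 / 25 * \<gamma> * S)"
  define T where "T = \<gamma>\<^sup>2 * normal_density 0 \<gamma> y"
  have S2: "S\<^sup>2 = d\<^sup>2 + t\<^sup>2" by (simp add: S_def)
  have dS: "d \<le> S" unfolding S_def by (intro real_le_rsqrt) simp
  with d have S: "0 < S" by linarith
  have G: "0 < G" unfolding G_def using gamma_pos S by (intro mult_pos_pos add_pos_pos) auto
  have y: "0 < y" and y2: "y\<^sup>2 = G * S / d"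
    unfolding y_def using G S d by simp_all
  have T: "y * T \<le> \<gamma>\<^sup>2 * (13 / 50)" "y\<^sup>2 * T \<le> \<gamma>\<^sup>2 * (8 / 25 * \<gamma>)"
    using mult_left_mono[OF normal_density_mult_le[OF y gamma_pos], of "\<gamma>\<^sup>2"]
      mult_left_mono[OF normal_density_mult_power2_le[OF y gamma_pos], of "\<gamma>\<^sup>2"]
    by (simp_all add: T_def mult.left_commute)
  \<comment> \<open>Completing the square compares \<open>C\<close> with G^2; the -1 / 4 coefficient
    of \<gamma> * S is 39 / 100 - 16 / 25.\<close>
  have "0 \<le> (\<gamma> / 4 - S / 2)\<^sup>2 + 123 / 1250 * S\<^sup>2" by simp
  also have "\<dots> = (\<gamma> / 4 + 39 / 50 * S)\<^sup>2 - (13 / 50 * S\<^sup>2 + 16 / 25 * \<gamma> * S)"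
    by (simp add: power2_eq_square algebra_simps)
  finally have CG: "C \<le> G\<^sup>2"
    unfolding C_def G_def power_mult_distrib by (intro mult_left_mono) auto
  \<comment> \<open>Over the common denominator y^2, the two density estimates apply to one summand
    each.\<close>
  have "(S\<^sup>2 / y + 2 * S) * T = (S\<^sup>2 * (y * T) + 2 * S * (y\<^sup>2 * T)) / y\<^sup>2"
    using y by (simp add: field_simps power2_eq_square)
  also have "\<dots> \<le> (S\<^sup>2 * (\<gamma>\<^sup>2 * (13 / 50)) + 2 * S * (\<gamma>\<^sup>2 * (8 / 25 * \<gamma>))) / y\<^sup>2"
    using S by (intro divide_right_mono add_mono mult_left_mono T) auto
  also have "\<dots> = C / y\<^sup>2"
    by (simp add: C_def algebra_simps)
  also have "\<dots> \<le> G\<^sup>2 / y\<^sup>2"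
    using CG by (intro divide_right_mono) auto
  also have "\<dots> = G * d / S"
    using G S d unfolding y2 by (simp add: power2_eq_square)
  finally have 1: "(S\<^sup>2 / y + 2 * S) * T \<le> G * d / S" .
  have 2: "y\<^sup>2 * (d\<^sup>2 / S\<^sup>2) = G * d / S"
    using G S d unfolding y2 by (simp add: power2_eq_square)
  \<comment> \<open>The summand \<gamma> / 4 of \<open>G\<close> yields the extra \<gamma>^2 / 2, as
    d \<le> S; in the other summand \<open>S\<close> cancels.\<close>
  have "2 * (G * d / S) = \<gamma>\<^sup>2 / 2 * (d / S) + 39 / 25 * d * \<gamma>"
    unfolding G_def using S
    by (simp add: distrib_left distrib_right add_divide_distrib power2_eq_square mult_ac)
  also have "\<gamma>\<^sup>2 / 2 * (d / S) \<le> \<gamma>\<^sup>2 / 2 * 1"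
    using dS S by (intro mult_left_mono) auto
  finally have "risk N D tp y tp \<le> 3 / 2 * \<gamma>\<^sup>2 + 39 / 25 * d * \<gamma>"
    using risk_true_le[OF mean var y d S S2 t_def] 1 2 unfolding T_def by linarith
  with y show ?thesis by (intro exI[of _ y]) auto
qed

section \<open>Passage to the infimum, the covariance matrix and the conclusion\<close>

lemma z_asy_bounds:
  assumes "compact \<Theta>" "tp \<in> \<Theta>"
  shows "\<gamma>\<^sup>2 \<le> z_asy N D \<Theta> tp"
    and "0 \<le> y \<Longrightarrow> z_asy N D \<Theta> tp \<le> risk N D tp y tp"
proof -
  have ge: "\<gamma>\<^sup>2 \<le> (LEAST r. r \<in> risk N D tp y ` \<Theta>)" if "0 \<le> y" for y
    using Least_risk(1)[OF assms, of y] risk_ge[OF that] by fastforce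
  then show "\<gamma>\<^sup>2 \<le> z_asy N D \<Theta> tp"
    unfolding z_asy_def by (intro cINF_greatest) auto
  assume y: "0 \<le> y"
  \<comment> \<open>A real \<open>INF\<close> lies below its members only for a family bounded
    below; the lower bound already proved ensures this.\<close>
  have "bdd_below ((\<lambda>y. LEAST r. r \<in> risk N D tp y ` \<Theta>) ` {0..})"
    using ge by (intro bdd_belowI2[of _ "\<gamma>\<^sup>2"]) auto
  then have "z_asy N D \<Theta> tp \<le> (LEAST r. r \<in> risk N D tp y ` \<Theta>)"
    unfolding z_asy_def using y by (intro cINF_lower) auto
  also have "\<dots> \<le> risk N D tp y tp"
    by (rule Least_risk(2)[OF assms])
  finally show "z_asy N D \<Theta> tp \<le> risk N D tp y tp" .
qed

end

text \<open>Since N is centred, covariances are plain mixed moments, finite by \<bar>a * c\<bar>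
  \<le> a^2 + c^2; expanding the square gives the quadratic form.\<close>

lemma inner_covariance_matrix:
  fixes N :: "(real ^ 'p) measure"
  assumes sets [measurable_cong]: "sets N = sets borel" and int: "integrable N (\<lambda>x. x)"
    and mean: "(\<integral>x. x \<partial>N) = 0"
    and sq: "\<forall>i. integrable N (\<lambda>x. (x $ i)\<^sup>2)"
  shows "b \<bullet> (covariance_matrix N *v b) = (\<integral>x. (x \<bullet> b)\<^sup>2 \<partial>N)"
proof -
  have "(\<integral>x. x $ i \<partial>N) = (\<integral>x. x \<partial>N) $ i" for i
    by (rule integral_bounded_linear[OF bounded_linear_vec_nth int])
  then have cov: "covariance_matrix N $ i $ j = (\<integral>x. x $ i * x $ j \<partial>N)" for i j
    by (simp add: covariance_matrix_def mean)
  have prod: "integrable N (\<lambda>x. x $ i * x $ j)" for i j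
  proof (rule Bochner_Integration.integrable_bound)
    show "integrable N (\<lambda>x. (x $ i)\<^sup>2 + (x $ j)\<^sup>2)" using sq by simp
    have "\<bar>a * c\<bar> \<le> a\<^sup>2 + c\<^sup>2" for a c :: real
      using zero_le_power2[of "\<bar>a\<bar> - \<bar>c\<bar>"] mult_nonneg_nonneg[of "\<bar>a\<bar>" "\<bar>c\<bar>"]
      unfolding power2_diff abs_mult power2_abs by linarith
    then show "AE x in N. norm (x $ i * x $ j) \<le> norm ((x $ i)\<^sup>2 + (x $ j)\<^sup>2)"
      by simp
  qed measurable
  have "(x \<bullet> b)\<^sup>2 = (\<Sum>i\<in>UNIV. \<Sum>j\<in>UNIV. b $ i * b $ j * (x $ i * x $ j))" for x
    by (simp add: inner_vec_def power2_eq_square sum_product mult_ac)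
  then have "(\<integral>x. (x \<bullet> b)\<^sup>2 \<partial>N) = (\<Sum>i\<in>UNIV. \<Sum>j\<in>UNIV. b $ i * b $ j * (\<integral>x. x $ i * x $ j \<partial>N))"
    using prod by simp
  also have "\<dots> = b \<bullet> (covariance_matrix N *v b)"
    by (simp add: inner_vec_def matrix_vector_mult_def cov sum_distrib_left mult_ac)
  finally show ?thesis by simp
qed

theorem theorem3:
  fixes \<Theta> :: "((real ^ 'p) \<times> real) set"
    and \<beta>s :: "real ^ 'p" and \<beta>0s :: real
    and N :: "(real ^ 'p) measure" and D :: "real measure"
    and \<Sigma> :: "real ^ 'p ^ 'p" and \<gamma> \<Delta> :: real
  assumes "convex \<Theta>" and "compact \<Theta>" and "(\<beta>s, \<beta>0s) \<in> \<Theta>"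
    and "prob_space N" and "sets N = sets borel"
    and "integrable N (\<lambda>x. x)" and "(\<integral>x. x \<partial>N) = 0"
    and "\<forall>i. integrable N (\<lambda>x. (x $ i)\<^sup>2)"
    and "\<Sigma> = covariance_matrix N" and "positive_semidefinite \<Sigma>"
    and "unique_optimal_property N \<Theta>"
    and "0 < \<gamma>" and "D = density lborel (normal_density 0 \<gamma>)"
    and "\<Delta>\<^sup>2 = \<beta>s \<bullet> (\<Sigma> *v \<beta>s)"
  shows "\<gamma>\<^sup>2 \<le> z_asy N D \<Theta> (\<beta>s, \<beta>0s) \<and>
         z_asy N D \<Theta> (\<beta>s, \<beta>0s) \<le> 3 * \<gamma>\<^sup>2 / 2 + (2 + 2 * \<Delta>\<^sup>2) / sqrt (2 * pi) * \<gamma>"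
proof -
  have "(norm x)\<^sup>2 = (\<Sum>i\<in>UNIV. (x $ i)\<^sup>2)" for x :: "real ^ 'p"
    by (simp add: norm_vec_def L2_set_def sum_nonneg)
  then have "integrable N (\<lambda>x. (norm x)\<^sup>2)"
    using assms(8) by simp
  then interpret gaussian_regression N D \<gamma>
    using assms by (intro gaussian_regression.intro gaussian_regression_axioms.intro)
  \<comment> \<open>Unlike \<bar>\<Delta>\<bar>, this \<open>d\<close> is positive even for \<Delta>
    = 0, which the division by \<open>d\<close> in the choice of \<open>y\<close> requires.\<close>
  define d where "d = (1 + \<Delta>\<^sup>2) / 2"
  have d: "0 < d" by (simp add: d_def add_pos_nonneg)
  have "\<bar>\<Delta>\<bar> \<le> d"
    using zero_le_power2[of "\<bar>\<Delta>\<bar> - 1"] by (simp add: d_def power2_diff)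
  then have "\<Delta>\<^sup>2 \<le> d\<^sup>2"
    using d by (intro abs_le_square_iff[THEN iffD1]) auto
  then have var: "(\<integral>x. (x \<bullet> \<beta>s)\<^sup>2 \<partial>N) \<le> d\<^sup>2"
    using inner_covariance_matrix[OF assms(5-8), of \<beta>s] assms(9,14) by simp
  have mean: "(\<integral>x. x \<bullet> \<beta>s \<partial>N) = 0"
    using integral_bounded_linear[OF bounded_linear_inner_left assms(6), of \<beta>s] assms(7) by simp
  obtain y where y: "0 \<le> y"
    "risk N D (\<beta>s, \<beta>0s) y (\<beta>s, \<beta>0s) \<le> 3 / 2 * \<gamma>\<^sup>2 + 39 / 25 * d * \<gamma>"
    using exists_risk_true_le[of "(\<beta>s, \<beta>0s)", OF _ _ d] mean var by auto
  \<comment> \<open>Here 4 * d = 2 + 2 * \<Delta>^2 and 39 / 25 = 4 * 39 / 100.\<close>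
  have "39 / 25 * d * \<gamma> \<le> (2 + 2 * \<Delta>\<^sup>2) / sqrt (2 * pi) * \<gamma>"
  proof (rule mult_right_mono)
    have "39 / 25 * d = (2 + 2 * \<Delta>\<^sup>2) / (100 / 39)"
      by (simp add: d_def field_simps)
    also have "\<dots> \<le> (2 + 2 * \<Delta>\<^sup>2) / sqrt (2 * pi)"
      using sqrt_2_pi_bounds by (intro divide_left_mono) auto
    finally show "39 / 25 * d \<le> (2 + 2 * \<Delta>\<^sup>2) / sqrt (2 * pi)" .
  qed (use assms(12) in simp)
  then show ?thesis
    using z_asy_bounds[OF assms(2,3)] y by fastforce
qed

end
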